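(* Let $H$ be an arbitrary infinite group and let $V \subseteq F_\infty$ be an arbitrary non-trivial word set. Then: (A) there exists a group $G$ of the same cardinality as $H$ such that $G$ has a subnormal subgroup $\tilde H \cong H$ with $\tilde H \subseteq V(G)$; (B) if $H$ is countable, the (countable) group $G$ in (A) can be chosen to be two-generated; (C) if $H$ is solvable, then the group $G$ in (A) can be chosen to be solvable, and, if $H$ is moreover countable, the two-generated group $G$ in (B) can be chosen to be solvable as well.
   Context: $F_\infty$ denotes the free group of countably infinite rank; its elements are called words. A word set is a subset $V \subseteq F_\infty$; it is non-trivial if it contains a word different from the identity of $F_\infty$. For a group $G$, the verbal subgroup $V(G)$ is the subgroup of $G$ generated by all values in $G$ of the words of $V$, i.e. by all images of elements of $V$ under homomorphisms $F_\infty \to G$. A subgroup $S$ of $G$ is subnormal if there is a finite chain $S = S_0 \trianglelefteq S_1 \trianglelefteq \dots \trianglelefteq S_d = G$. A group is two-generated if it can be generated by two elements. *)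

theory Defs
  imports "HOL-Algebra.Algebra" "HOL-Library.Equipollence" "HOL-Library.Countable_Set"
begin

text \<open>
  The letter \<open>(i, True)\<close> stands for the free generator \<open>x i\<close> and \<open>(i, False)\<close> for its inverse.
  Elements of the free group of countably infinite rank are represented by reduced lists of
  letters; \<open>push_letter a w\<close> is the reduced form of \<open>a # w\<close> for a reduced list \<open>w\<close>.
\<close>

type_synonym letter = "nat \<times> bool"

definition inv_letter :: "letter \<Rightarrow> letter"
  where "inv_letter a = (fst a, \<not> snd a)"

definition reduced :: "letter list \<Rightarrow> bool"
  where "reduced w \<longleftrightarrow> successively (\<lambda>a b. b \<noteq> inv_letter a) w"

fun push_letter :: "letter \<Rightarrow> letter list \<Rightarrow> letter list" where
  "push_letter a [] = [a]"
| "push_letter a (b # w) = (if b = inv_letter a then w else a # b # w)"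

definition free_group_inf :: "letter list monoid"  (\<open>F\<^sub>\<infinity>\<close>)
  where "F\<^sub>\<infinity> = \<lparr>carrier = {w. reduced w}, monoid.mult = (\<lambda>u v. foldr push_letter u v), one = []\<rparr>"

definition verbal_subgroup :: "letter list set \<Rightarrow> ('a, 'b) monoid_scheme \<Rightarrow> 'a set"
  where "verbal_subgroup V G = generate G {\<phi> w | \<phi> w. \<phi> \<in> hom F\<^sub>\<infinity> G \<and> w \<in> V}"

definition subnormal :: "'a set \<Rightarrow> ('a, 'b) monoid_scheme \<Rightarrow> bool"
  where "subnormal S G \<longleftrightarrow>
    (\<exists>(d :: nat) C. C 0 = S \<and> C d = carrier G \<and> (\<forall>i\<le>d. subgroup (C i) G) \<and>
       (\<forall>i<d. C i \<lhd> (G\<lparr>carrier := C (Suc i)\<rparr>)))"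

definition two_generated :: "('a, 'b) monoid_scheme \<Rightarrow> bool"
  where "two_generated G \<longleftrightarrow> (\<exists>a\<in>carrier G. \<exists>b\<in>carrier G. generate G {a, b} = carrier G)"

definition subnormal_verbal_embedding ::
  "letter list set \<Rightarrow> ('a, 'b) monoid_scheme \<Rightarrow> ('c, 'd) monoid_scheme \<Rightarrow> bool"
  where "subnormal_verbal_embedding V H G \<longleftrightarrow>
    (\<exists>S. subnormal S G \<and> (G\<lparr>carrier := S\<rparr>) \<cong> H \<and> S \<subseteq> verbal_subgroup V G)"


text \<open>The rest of this theory confirms that \<open>F\<^sub>\<infinity>\<close> is a group, free on the elements \<open>[(i, True)]\<close>.\<close>

lemma inv_letter_inv_letter [simp]: "inv_letter (inv_letter a) = a"
  by (simp add: inv_letter_def)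

lemma inv_letter_neq [simp]: "inv_letter a \<noteq> a" "a \<noteq> inv_letter a"
  by (cases a; simp add: inv_letter_def)+

lemma reduced_Nil [simp]: "reduced []"
  by (simp add: reduced_def)

lemma reduced_Cons: "reduced (a # w) \<longleftrightarrow> reduced w \<and> (w = [] \<or> hd w \<noteq> inv_letter a)"
  by (auto simp: reduced_def successively_Cons)

lemma reduced_push_letter: "reduced w \<Longrightarrow> reduced (push_letter a w)"
  by (cases w) (auto simp: reduced_Cons)

lemma reduced_foldr_push_letter: "reduced w \<Longrightarrow> reduced (foldr push_letter u w)"
  by (induction u) (auto intro: reduced_push_letter)

lemma push_letter_inv_letter:
  assumes "reduced w"
  shows "push_letter a (push_letter (inv_letter a) w) = w"
  using assms by (cases w; cases "tl w") (auto simp: reduced_Cons)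

lemma push_letter_inv_letter':
  assumes "reduced w"
  shows "push_letter (inv_letter a) (push_letter a w) = w"
  using push_letter_inv_letter[OF assms, of "inv_letter a"] by simp

lemma foldr_push_letter_push_letter:
  assumes "reduced w"
  shows "foldr push_letter (push_letter a u) w = push_letter a (foldr push_letter u w)"
proof (cases u)
  case Nil
  then show ?thesis by simp
next
  case (Cons b v)
  then show ?thesis
    using push_letter_inv_letter[OF reduced_foldr_push_letter[OF assms], of a v] by simp
qed

lemma foldr_push_letter_assoc:
  assumes "reduced w"
  shows "foldr push_letter (foldr push_letter u v) w = foldr push_letter u (foldr push_letter v w)"
  by (induction u) (simp_all add: foldr_push_letter_push_letter[OF assms])

lemma push_letter_reduced: "reduced (a # w) \<Longrightarrow> push_letter a w = a # w"
  by (cases w) (auto simp: reduced_Cons)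

lemma foldr_push_letter_Nil: "reduced u \<Longrightarrow> foldr push_letter u [] = u"
  by (induction u) (auto simp: push_letter_reduced reduced_Cons simp del: push_letter.simps)

lemma foldr_push_letter_inverse:
  assumes "reduced w"
  shows "foldr push_letter (map inv_letter (rev u)) (foldr push_letter u w) = w"
  using assms
  by (induction u arbitrary: w)
     (simp_all add: push_letter_inv_letter' reduced_foldr_push_letter)

lemma group_free_group_inf: "group F\<^sub>\<infinity>"
proof (rule groupI)
  fix u v w
  assume "u \<in> carrier F\<^sub>\<infinity>" "v \<in> carrier F\<^sub>\<infinity>" "w \<in> carrier F\<^sub>\<infinity>"
  then show "u \<otimes>\<^bsub>F\<^sub>\<infinity>\<^esub> v \<otimes>\<^bsub>F\<^sub>\<infinity>\<^esub> w = u \<otimes>\<^bsub>F\<^sub>\<infinity>\<^esub> (v \<otimes>\<^bsub>F\<^sub>\<infinity>\<^esub> w)"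
    by (simp add: free_group_inf_def foldr_push_letter_assoc)
next
  fix u
  assume "u \<in> carrier F\<^sub>\<infinity>"
  then have "reduced u"
    by (simp add: free_group_inf_def)
  let ?v = "foldr push_letter (map inv_letter (rev u)) []"
  have "foldr push_letter ?v u = []"
    using foldr_push_letter_inverse[of "[]" u] \<open>reduced u\<close>
    by (simp add: foldr_push_letter_assoc foldr_push_letter_Nil)
  moreover have "reduced ?v"
    by (simp add: reduced_foldr_push_letter)
  ultimately show "\<exists>v\<in>carrier F\<^sub>\<infinity>. v \<otimes>\<^bsub>F\<^sub>\<infinity>\<^esub> u = \<one>\<^bsub>F\<^sub>\<infinity>\<^esub>"
    unfolding free_group_inf_def monoid.simps partial_object.simps by blast
qed (simp_all add: free_group_inf_def reduced_foldr_push_letter)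

definition letter_value :: "('a, 'b) monoid_scheme \<Rightarrow> (nat \<Rightarrow> 'a) \<Rightarrow> letter \<Rightarrow> 'a"
  where "letter_value G x a = (if snd a then x (fst a) else inv\<^bsub>G\<^esub> x (fst a))"

definition word_value :: "('a, 'b) monoid_scheme \<Rightarrow> (nat \<Rightarrow> 'a) \<Rightarrow> letter list \<Rightarrow> 'a"
  where "word_value G x w = foldr (\<lambda>a g. letter_value G x a \<otimes>\<^bsub>G\<^esub> g) w \<one>\<^bsub>G\<^esub>"

context group
begin

lemma word_value_Nil [simp]: "word_value G x [] = \<one>"
  by (simp add: word_value_def)

lemma word_value_Cons [simp]: "word_value G x (a # w) = letter_value G x a \<otimes> word_value G x w"
  by (simp add: word_value_def)

lemma letter_value_closed: "range x \<subseteq> carrier G \<Longrightarrow> letter_value G x a \<in> carrier G"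
  by (auto simp: letter_value_def)

lemma word_value_closed: "range x \<subseteq> carrier G \<Longrightarrow> word_value G x w \<in> carrier G"
  by (induction w) (auto simp: letter_value_closed)

lemma letter_value_inv_letter:
  "range x \<subseteq> carrier G \<Longrightarrow> letter_value G x (inv_letter a) = inv (letter_value G x a)"
  by (simp add: letter_value_def inv_letter_def range_subsetD)

lemma word_value_push_letter:
  assumes x: "range x \<subseteq> carrier G"
  shows "word_value G x (push_letter a w) = letter_value G x a \<otimes> word_value G x w"
  by (cases w)
     (simp_all add: letter_value_inv_letter[OF x] letter_value_closed[OF x]
       word_value_closed[OF x] m_assoc[symmetric])

lemma word_value_hom:
  assumes x: "range x \<subseteq> carrier G"
  shows "word_value G x \<in> hom F\<^sub>\<infinity> G"
proof (rule homI)
  fix u v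
  show "word_value G x (u \<otimes>\<^bsub>F\<^sub>\<infinity>\<^esub> v) = word_value G x u \<otimes> word_value G x v"
    by (induction u)
       (simp_all add: free_group_inf_def word_value_push_letter[OF x] m_assoc
         letter_value_closed[OF x] word_value_closed[OF x])
qed (rule word_value_closed[OF x])

lemma word_value_generator: "range x \<subseteq> carrier G \<Longrightarrow> word_value G x [(i, True)] = x i"
  by (simp add: letter_value_def range_subsetD)

lemma hom_free_group_inf_unique:
  assumes h: "h \<in> hom F\<^sub>\<infinity> G" and w: "w \<in> carrier F\<^sub>\<infinity>"
  shows "h w = word_value G (\<lambda>i. h [(i, True)]) w"
proof -
  interpret F: group "F\<^sub>\<infinity>" by (rule group_free_group_inf)
  interpret h: group_hom "F\<^sub>\<infinity>" G h
    using h by unfold_locales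
  let ?x = "\<lambda>i. h [(i, True)]"
  have single: "[a] \<in> carrier F\<^sub>\<infinity>" for a
    by (simp add: free_group_inf_def reduced_Cons)
  have letter: "h [a] = letter_value G ?x a" for a
  proof (cases a)
    case (Pair i b)
    have "[(i, False)] \<otimes>\<^bsub>F\<^sub>\<infinity>\<^esub> [(i, True)] = \<one>\<^bsub>F\<^sub>\<infinity>\<^esub>"
      by (simp add: free_group_inf_def inv_letter_def)
    then have "inv\<^bsub>F\<^sub>\<infinity>\<^esub> [(i, True)] = [(i, False)]"
      by (intro F.inv_equality single)
    then have "h [(i, False)] = inv (h [(i, True)])"
      using h.hom_inv[OF single] by metis
    then show ?thesis
      using Pair by (cases b) (simp_all add: letter_value_def)
  qed
  show ?thesis
    using w
  proof (induction w)
    case Nil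
    then show ?case
      using h.hom_one by (simp add: free_group_inf_def)
  next
    case (Cons a w)
    then have w: "w \<in> carrier F\<^sub>\<infinity>" and "a # w = [a] \<otimes>\<^bsub>F\<^sub>\<infinity>\<^esub> w"
      by (simp_all add: free_group_inf_def reduced_Cons push_letter_reduced)
    then have "h (a # w) = h [a] \<otimes> h w"
      using h.hom_mult[OF single w] by metis
    then show ?case
      unfolding word_value_Cons letter[symmetric] Cons.IH[OF w, symmetric] .
  qed
qed

end

end

theory Submission
  imports Defs
begin

text \<open>
  In a wreath product of \<open>A\<close> with a group acting on \<open>\<Omega>\<close>, let \<open>\<phi> a\<close> take the value \<open>a\<close> on the
  ray \<open>{v u, v (v u), \<dots>}\<close> of an infinite orbit of \<open>v\<close> and be trivial elsewhere. The
  commutator of \<open>v\<close> and \<open>\<phi> a\<close> telescopes to the function that is \<open>a\<close> at \<open>u\<close> and trivial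
  elsewhere, and these functions form a subnormal copy of \<open>A\<close>. If \<open>v\<close> is a value of a word of
  \<open>V\<close>, such commutators lie in the verbal subgroup. So \<open>H\<close> embeds as required as soon as a
  solvable group acts with a word value that has an infinite orbit; triangular
  permutations of integer sequences provide this for every non-trivial word.

  For countable \<open>A\<close>, let \<open>W = A Wr \<int>\<close> with generator \<open>z\<close> of \<open>\<int>\<close>, and let \<open>\<psi> : \<int> \<rightarrow> W\<close> take the value
  \<open>z\<close> at \<open>0\<close> and \<open>\<phi> a\<^sub>i\<close> at \<open>2 i + 1\<close>. As \<open>\<psi>\<close> is supported on \<open>0\<close> and the positive odd numbers, \<open>\<psi>\<close>
  and its shift by \<open>2 i + 1\<close> are both non-trivial only at \<open>0\<close>, so their commutator is \<open>[z, \<phi> a\<^sub>i]\<close>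
  concentrated at \<open>0\<close>. Hence the group generated by \<open>\<psi>\<close> and the shift contains a subnormal copy
  of \<open>A\<close>.
\<close>

no_notation iso_incl (infixl \<open>\<lesssim>\<close> 65)

section \<open>Subnormal subgroups\<close>

text \<open>Products and inverses are those of \<open>G\<close>, so that terms of a chain of
  subgroups are compared without nested carriers.\<close>

lemma (in group) normal_in_subgroupI:
  assumes "subgroup N G" "subgroup K G" "N \<subseteq> K"
    and "\<And>k n. k \<in> K \<Longrightarrow> n \<in> N \<Longrightarrow> k \<otimes> n \<otimes> inv k \<in> N"
  shows "N \<lhd> (G\<lparr>carrier := K\<rparr>)"
proof -
  interpret K: group "G\<lparr>carrier := K\<rparr>"
    using assms(2) subgroup_imp_group by blast
  show ?thesis
    using assms subgroup_incl[OF assms(1-3)]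
    by (auto simp: K.normal_inv_iff m_inv_consistent)
qed

lemma (in group) normal_in_subgroupD:
  assumes "N \<lhd> (G\<lparr>carrier := K\<rparr>)" "subgroup K G"
  shows "subgroup N G" "N \<subseteq> K"
    and "\<And>k n. k \<in> K \<Longrightarrow> n \<in> N \<Longrightarrow> k \<otimes> n \<otimes> inv k \<in> N"
proof -
  interpret K: group "G\<lparr>carrier := K\<rparr>"
    using assms(2) subgroup_imp_group by blast
  have N: "subgroup N (G\<lparr>carrier := K\<rparr>)"
    using assms(1) K.normal_inv_iff by blast
  then show "subgroup N G"
    using incl_subgroup[OF assms(2)] by blast
  show "N \<subseteq> K"
    using subgroup.subset[OF N] by simp
  show "k \<otimes> n \<otimes> inv k \<in> N" if "k \<in> K" "n \<in> N" for k n
    using that assms K.normal_inv_iff by (auto simp: m_inv_consistent)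
qed

lemma (in group) subnormal_carrier: "subnormal (carrier G) G"
  unfolding subnormal_def
  by (intro exI[of _ 0] exI[of _ "\<lambda>_. carrier G"]) (auto intro: subgroup_self)

lemma (in group) subnormal_normal:
  assumes "N \<lhd> (G\<lparr>carrier := K\<rparr>)" "subnormal K G"
  shows "subnormal N G"
proof -
  obtain d C where C: "C 0 = K" "C d = carrier G" "\<And>i. i \<le> d \<Longrightarrow> subgroup (C i) G"
      "\<And>i. i < d \<Longrightarrow> C i \<lhd> (G\<lparr>carrier := C (Suc i)\<rparr>)"
    using assms(2) unfolding subnormal_def by blast
  have "subgroup N G"
    using normal_in_subgroupD(1)[OF assms(1)] C(3)[of 0] C(1) by simp
  then show ?thesis
    unfolding subnormal_def
    by (intro exI[of _ "Suc d"] exI[of _ "case_nat N C"])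
       (use C assms(1) in \<open>auto split: nat.split simp: less_Suc_eq_le\<close>)
qed

lemma (in group) subnormal_subgroup: "subnormal S G \<Longrightarrow> subgroup S G"
  unfolding subnormal_def by (metis le0)

text \<open>Each term of the chain is intersected with \<open>K\<close>. This carries subnormality
  from a full wreath product down to the subgroups generated inside it.\<close>

lemma (in group) subnormal_Int:
  assumes "subnormal S G" "subgroup K G" "S \<subseteq> K"
  shows "subnormal S (G\<lparr>carrier := K\<rparr>)"
proof -
  obtain d C where C: "C 0 = S" "C d = carrier G" "\<And>i. i \<le> d \<Longrightarrow> subgroup (C i) G"
      "\<And>i. i < d \<Longrightarrow> C i \<lhd> (G\<lparr>carrier := C (Suc i)\<rparr>)"
    using assms(1) unfolding subnormal_def by blast
  interpret K: group "G\<lparr>carrier := K\<rparr>"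
    using assms(2) subgroup_imp_group by blast
  have sub: "subgroup (C i \<inter> K) (G\<lparr>carrier := K\<rparr>)" if "i \<le> d" for i
    using subgroup_incl[OF subgroups_Inter_pair[OF C(3)[OF that] assms(2)] assms(2)] by simp
  have "C i \<inter> K \<lhd> (G\<lparr>carrier := K\<rparr>\<lparr>carrier := C (Suc i) \<inter> K\<rparr>)" if "i < d" for i
  proof (rule K.normal_in_subgroupI[OF sub sub])
    note D = normal_in_subgroupD[OF C(4)[OF that] C(3)]
    show "C i \<inter> K \<subseteq> C (Suc i) \<inter> K"
      using D(2) that by auto
    fix k n assume "k \<in> C (Suc i) \<inter> K" "n \<in> C i \<inter> K"
    then show "k \<otimes>\<^bsub>G\<lparr>carrier := K\<rparr>\<^esub> n \<otimes>\<^bsub>G\<lparr>carrier := K\<rparr>\<^esub> inv\<^bsub>G\<lparr>carrier := K\<rparr>\<^esub> k \<in> C i \<inter> K"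
      using D(3)[of k n] that assms(2)
      by (auto simp: m_inv_consistent intro: subgroup.m_closed subgroup.m_inv_closed)
  qed (use that in auto)
  then show ?thesis
    unfolding subnormal_def
    by (intro exI[of _ d] exI[of _ "\<lambda>i. C i \<inter> K"])
       (use C assms subgroup.subset[OF assms(2)] sub in auto)
qed

text \<open>Normality of consecutive terms survives taking images, so the image of the chain
  descends from the image of \<open>G\<close>, which the second assumption links to
  \<open>H\<close>.\<close>

lemma (in group_hom) subnormal_image:
  assumes "subnormal S G" "subnormal (h ` carrier G) H"
  shows "subnormal (h ` S) H"
proof -
  obtain d C where C: "C 0 = S" "C d = carrier G" "\<And>i. i \<le> d \<Longrightarrow> subgroup (C i) G"
      "\<And>i. i < d \<Longrightarrow> C i \<lhd> (G\<lparr>carrier := C (Suc i)\<rparr>)"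
    using assms(1) unfolding subnormal_def by blast
  have "k \<le> d \<Longrightarrow> subnormal (h ` C k) H" for k
  proof (induction k rule: inc_induct)
    case base
    then show ?case using assms(2) C(2) by simp
  next
    case (step k)
    note D = G.normal_in_subgroupD[OF C(4) C(3), OF step.hyps(2)] 
    have sub: "subgroup (C k) G" "subgroup (C (Suc k)) G"
      using C(3) step.hyps by auto
    have "h ` C k \<lhd> (H\<lparr>carrier := h ` C (Suc k)\<rparr>)"
    proof (rule H.normal_in_subgroupI)
      show "h ` C k \<subseteq> h ` C (Suc k)"
        using D(2) step.hyps by auto
      fix x y assume "x \<in> h ` C (Suc k)" "y \<in> h ` C k"
      then obtain a b where ab: "a \<in> C (Suc k)" "b \<in> C k" "x = h a" "y = h b"
        by blast
      then have "a \<in> carrier G" "b \<in> carrier G"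
        using sub subgroup.subset by blast+
      then have "x \<otimes>\<^bsub>H\<^esub> y \<otimes>\<^bsub>H\<^esub> inv\<^bsub>H\<^esub> x = h (a \<otimes> b \<otimes> inv a)"
        using ab by simp
      then show "x \<otimes>\<^bsub>H\<^esub> y \<otimes>\<^bsub>H\<^esub> inv\<^bsub>H\<^esub> x \<in> h ` C k"
        using D(3)[OF _ ab(1,2)] step.hyps by auto
    qed (use sub subgroup_img_is_subgroup in auto)
    then show ?case
      using H.subnormal_normal step.IH by blast
  qed
  then show ?thesis
    using C(1) by force
qed

section \<open>Verbal subgroups\<close>

text \<open>A value of a word under \<open>\<phi>\<close> goes to the value of the same word under
  \<open>h \<circ> \<phi>\<close>.\<close>

lemma (in group_hom) verbal_subgroup_image:
  assumes "V \<subseteq> carrier F\<^sub>\<infinity>"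
  shows "h ` verbal_subgroup V G \<subseteq> verbal_subgroup V H"
proof -
  let ?S = "{\<phi> w |\<phi> w. \<phi> \<in> hom F\<^sub>\<infinity> G \<and> w \<in> V}"
  have "?S \<subseteq> carrier G"
    using assms by (auto simp: hom_def)
  moreover have "h ` ?S \<subseteq> {\<phi> w |\<phi> w. \<phi> \<in> hom F\<^sub>\<infinity> H \<and> w \<in> V}"
  proof clarsimp
    fix \<phi> w assume "\<phi> \<in> hom F\<^sub>\<infinity> G" "w \<in> V"
    then have "h \<circ> \<phi> \<in> hom F\<^sub>\<infinity> H"
      using homh Group.hom_compose by blast
    with \<open>w \<in> V\<close> show "\<exists>\<phi>' w'. h (\<phi> w) = \<phi>' w' \<and> \<phi>' \<in> hom F\<^sub>\<infinity> H \<and> w' \<in> V"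
      by (intro exI[of _ "h \<circ> \<phi>"] exI[of _ w]) simp
  qed
  ultimately show ?thesis
    unfolding verbal_subgroup_def by (metis (no_types, lifting) generate_img H.mono_generate)
qed

text \<open>The copy of \<open>H\<close> is pushed forward along \<open>h\<close>. This serves both
  for enlarging \<open>G\<close> to a two-generated group and for renaming its elements.\<close>

lemma subnormal_verbal_embedding_trans:
  assumes "subnormal_verbal_embedding V H G" "group_hom G G' h" "inj_on h (carrier G)"
    and "subnormal (h ` carrier G) G'" "V \<subseteq> carrier F\<^sub>\<infinity>"
  shows "subnormal_verbal_embedding V H G'"
proof -
  interpret group_hom G G' h by fact
  obtain S where S: "subnormal S G" "(G\<lparr>carrier := S\<rparr>) \<cong> H" "S \<subseteq> verbal_subgroup V G"
    using assms(1) unfolding subnormal_verbal_embedding_def by blast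
  have sub: "subgroup S G"
    using S(1) G.subnormal_subgroup by blast
  have "h \<in> iso (G\<lparr>carrier := S\<rparr>) (G'\<lparr>carrier := h ` S\<rparr>)"
    using subgroup.subset[OF sub] inj_on_subset[OF assms(3)]
    by (auto simp: iso_def bij_betw_def hom_def subset_iff)
  then have "(G'\<lparr>carrier := h ` S\<rparr>) \<cong> H"
    using S(2) group.iso_sym[OF G.subgroup_imp_group[OF sub]] iso_trans
    unfolding is_iso_def by blast
  then show ?thesis
    unfolding subnormal_verbal_embedding_def
    using subnormal_image[OF S(1) assms(4)] verbal_subgroup_image[OF assms(5)] S(3) by blast
qed

section \<open>Wreath products\<close>

text \<open>
  The pair \<open>(f, p)\<close> stands for the permutation \<open>(x, a) \<mapsto> (p x, f x \<otimes> a)\<close> of \<open>\<Omega> \<times> A\<close>,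
  which makes the multiplication free of inverses.
\<close>

definition wreath_product ::
    "('a, 'b) monoid_scheme \<Rightarrow> ('p, 'q) monoid_scheme \<Rightarrow> ('p \<Rightarrow> 'w \<Rightarrow> 'w) \<Rightarrow>
     (('w \<Rightarrow> 'a) \<times> 'p) monoid"
  where "wreath_product A P act =
    \<lparr>carrier = {f. range f \<subseteq> carrier A} \<times> carrier P,
     monoid.mult = (\<lambda>(f, p) (g, q). (\<lambda>x. f (act q x) \<otimes>\<^bsub>A\<^esub> g x, p \<otimes>\<^bsub>P\<^esub> q)),
     one = (\<lambda>_. \<one>\<^bsub>A\<^esub>, \<one>\<^bsub>P\<^esub>)\<rparr>"

text \<open>The unrestricted direct power. As a group of its own it allows the solvability of the
  base of a wreath product to be checked coordinatewise.\<close>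

definition base_power :: "('a, 'b) monoid_scheme \<Rightarrow> ('w \<Rightarrow> 'a) monoid"
  where "base_power A =
    \<lparr>carrier = {f. range f \<subseteq> carrier A}, monoid.mult = (\<lambda>f g x. f x \<otimes>\<^bsub>A\<^esub> g x), one = (\<lambda>_. \<one>\<^bsub>A\<^esub>)\<rparr>"

locale wreath = A: group A + P: group P
  for A :: "('a, 'b) monoid_scheme" and P :: "('p, 'q) monoid_scheme" +
  fixes act :: "'p \<Rightarrow> 'w \<Rightarrow> 'w"
  assumes act_one: "act \<one>\<^bsub>P\<^esub> x = x"
    and act_mult: "p \<in> carrier P \<Longrightarrow> q \<in> carrier P \<Longrightarrow> act (p \<otimes>\<^bsub>P\<^esub> q) x = act p (act q x)"
begin

abbreviation W :: "(('w \<Rightarrow> 'a) \<times> 'p) monoid"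
  where "W \<equiv> wreath_product A P act"

definition top :: "'p \<Rightarrow> ('w \<Rightarrow> 'a) \<times> 'p"
  where "top p = (\<lambda>_. \<one>\<^bsub>A\<^esub>, p)"

definition base :: "('w \<Rightarrow> 'a) \<Rightarrow> ('w \<Rightarrow> 'a) \<times> 'p"
  where "base f = (f, \<one>\<^bsub>P\<^esub>)"

definition delta :: "'w \<Rightarrow> 'a \<Rightarrow> ('w \<Rightarrow> 'a) \<times> 'p"
  where "delta u a = base (\<lambda>x. if x = u then a else \<one>\<^bsub>A\<^esub>)"

lemma carrier_W: "(f, p) \<in> carrier W \<longleftrightarrow> range f \<subseteq> carrier A \<and> p \<in> carrier P"
  by (simp add: wreath_product_def)

lemma mult_W: "(f, p) \<otimes>\<^bsub>W\<^esub> (g, q) = (\<lambda>x. f (act q x) \<otimes>\<^bsub>A\<^esub> g x, p \<otimes>\<^bsub>P\<^esub> q)"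
  by (simp add: wreath_product_def)

lemma one_W: "\<one>\<^bsub>W\<^esub> = (\<lambda>_. \<one>\<^bsub>A\<^esub>, \<one>\<^bsub>P\<^esub>)"
  by (simp add: wreath_product_def)

lemma act_inv: "p \<in> carrier P \<Longrightarrow> act (inv\<^bsub>P\<^esub> p) (act p x) = x"
  by (metis P.inv_closed P.l_inv act_mult act_one)

lemma inj_act: "p \<in> carrier P \<Longrightarrow> inj (act p)"
  by (metis act_inv injI)

lemma group_W: "group W"
proof (rule groupI)
  fix x assume "x \<in> carrier W"
  then obtain f p where x: "x = (f, p)" "range f \<subseteq> carrier A" "p \<in> carrier P"
    by (cases x) (auto simp: carrier_W)
  let ?y = "(\<lambda>z. inv\<^bsub>A\<^esub> f (act (inv\<^bsub>P\<^esub> p) z), inv\<^bsub>P\<^esub> p)"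
  have "?y \<otimes>\<^bsub>W\<^esub> x = \<one>\<^bsub>W\<^esub>" "?y \<in> carrier W"
    using x by (auto simp: mult_W one_W carrier_W act_inv range_subsetD)
  then show "\<exists>y\<in>carrier W. y \<otimes>\<^bsub>W\<^esub> x = \<one>\<^bsub>W\<^esub>"
    by blast
qed (auto simp: mult_W one_W carrier_W act_mult act_one A.m_assoc P.m_assoc range_subsetD)

sublocale W: group W
  by (rule group_W)

lemma top_closed: "p \<in> carrier P \<Longrightarrow> top p \<in> carrier W"
  by (simp add: top_def carrier_W image_subset_iff)

lemma top_hom: "top \<in> hom P W"
  by (auto simp: hom_def top_closed) (simp add: top_def mult_W)

lemma base_closed: "range f \<subseteq> carrier A \<Longrightarrow> base f \<in> carrier W"
  by (simp add: base_def carrier_W)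

lemma base_mult: "base f \<otimes>\<^bsub>W\<^esub> base g = base (\<lambda>x. f x \<otimes>\<^bsub>A\<^esub> g x)"
  by (simp add: base_def mult_W act_one)

lemma base_inv: "range f \<subseteq> carrier A \<Longrightarrow> inv\<^bsub>W\<^esub> base f = base (\<lambda>x. inv\<^bsub>A\<^esub> f x)"
proof (rule W.inv_equality)
  assume f: "range f \<subseteq> carrier A"
  then show "base (\<lambda>x. inv\<^bsub>A\<^esub> f x) \<otimes>\<^bsub>W\<^esub> base f = \<one>\<^bsub>W\<^esub>"
    by (simp add: base_mult range_subsetD) (simp add: one_W base_def)
  show "base f \<in> carrier W" "base (\<lambda>x. inv\<^bsub>A\<^esub> f x) \<in> carrier W"
    using f by (auto intro!: base_closed simp: range_subsetD)
qed

lemma group_hom_top: "group_hom P W top"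
  using top_hom by unfold_locales

lemma top_inv: "p \<in> carrier P \<Longrightarrow> inv\<^bsub>W\<^esub> top p = top (inv\<^bsub>P\<^esub> p)"
  using group_hom.hom_inv[OF group_hom_top] by simp

lemma base_conj_top:
  assumes "p \<in> carrier P" "range f \<subseteq> carrier A"
  shows "inv\<^bsub>W\<^esub> top p \<otimes>\<^bsub>W\<^esub> base f \<otimes>\<^bsub>W\<^esub> top p = base (\<lambda>x. f (act p x))"
  using assms by (simp add: top_inv) (simp add: top_def base_def mult_W range_subsetD)

lemma group_hom_snd: "group_hom W P snd"
  by unfold_locales (auto simp: hom_def carrier_W mult_W)

lemma kernel_snd: "kernel W P snd = base ` {f. range f \<subseteq> carrier A}"
  by (auto simp: kernel_def carrier_W base_def)

section \<open>Copies of \<open>A\<close> concentrated at one point\<close>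

lemma delta_closed: "a \<in> carrier A \<Longrightarrow> delta u a \<in> carrier W"
  unfolding delta_def by (intro base_closed) auto

lemma group_hom_delta: "group_hom A W (delta u)"
proof unfold_locales
  show "delta u \<in> hom A W"
  proof (rule homI)
    fix a b assume "a \<in> carrier A" "b \<in> carrier A"
    then show "delta u (a \<otimes>\<^bsub>A\<^esub> b) = delta u a \<otimes>\<^bsub>W\<^esub> delta u b"
      by (auto simp: delta_def base_mult fun_eq_iff intro!: arg_cong[where f = base])
  qed (rule delta_closed)
qed

lemma inj_delta: "inj (delta u)"
proof (rule injI)
  fix a b assume "delta u a = delta u b"
  then have "fst (delta u a) u = fst (delta u b) u" by simp
  then show "a = b" by (simp add: delta_def base_def)
qed

text \<open>Conjugation by \<open>base f\<close> merely conjugates the value at \<open>u\<close> by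
  \<open>f u\<close>. So the copy is normal in the base group, which is normal in \<open>W\<close>
  as the kernel of the projection.\<close>

lemma subnormal_delta: "subnormal (delta u ` carrier A) W"
proof -
  let ?B = "kernel W P snd"
  interpret S: group_hom W P snd by (rule group_hom_snd)
  interpret D: group_hom A W "delta u" by (rule group_hom_delta)
  have B: "subgroup ?B W"
    using S.subgroup_kernel .
  have "delta u ` carrier A \<lhd> (W\<lparr>carrier := ?B\<rparr>)"
  proof (rule W.normal_in_subgroupI[OF D.img_is_subgroup B])
    show "delta u ` carrier A \<subseteq> ?B"
      by (auto simp: kernel_snd delta_def)
    fix k n assume "k \<in> ?B" "n \<in> delta u ` carrier A"
    then obtain f a where f: "k = base f" "range f \<subseteq> carrier A" "n = delta u a" "a \<in> carrier A"
      by (auto simp: kernel_snd)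
    then have "k \<otimes>\<^bsub>W\<^esub> n \<otimes>\<^bsub>W\<^esub> inv\<^bsub>W\<^esub> k = delta u (f u \<otimes>\<^bsub>A\<^esub> a \<otimes>\<^bsub>A\<^esub> inv\<^bsub>A\<^esub> f u)"
      by (auto simp: delta_def base_inv base_mult range_subsetD fun_eq_iff intro!: arg_cong[where f = base])
    then show "k \<otimes>\<^bsub>W\<^esub> n \<otimes>\<^bsub>W\<^esub> inv\<^bsub>W\<^esub> k \<in> delta u ` carrier A"
      using f(2,4) by (simp only:) (intro imageI A.m_closed A.inv_closed; auto)
  qed
  moreover have "?B \<lhd> (W\<lparr>carrier := carrier W\<rparr>)"
    using S.normal_kernel by simp
  ultimately show ?thesis
    using W.subnormal_normal W.subnormal_carrier by blast
qed

text \<open>The exponent starts at 1, which leaves \<open>u\<close> as the point that a shift by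
  \<open>v\<close> adds to the support.\<close>

definition ray :: "'p \<Rightarrow> 'w \<Rightarrow> 'a \<Rightarrow> ('w \<Rightarrow> 'a) \<times> 'p"
  where "ray v u a = base (\<lambda>x. if \<exists>m. x = (act v ^^ Suc m) u then a else \<one>\<^bsub>A\<^esub>)"

lemma ray_closed: "a \<in> carrier A \<Longrightarrow> ray v u a \<in> carrier W"
  unfolding ray_def by (intro base_closed) auto

text \<open>Conjugation by \<open>top v\<close> pulls the support of the ray back one step and so
  adds \<open>u\<close> to it; the inverse of the ray cancels the rest. The assumption on
  \<open>u\<close> keeps \<open>u\<close> off its own ray.\<close>

lemma commutator_ray:
  assumes v: "v \<in> carrier P" and u: "\<And>m. (act v ^^ Suc m) u \<noteq> u" and a: "a \<in> carrier A"
  shows "inv\<^bsub>W\<^esub> top v \<otimes>\<^bsub>W\<^esub> ray v u a \<otimes>\<^bsub>W\<^esub> top v \<otimes>\<^bsub>W\<^esub> inv\<^bsub>W\<^esub> ray v u a = delta u a"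
proof -
  let ?f = "\<lambda>x. if \<exists>m. x = (act v ^^ Suc m) u then a else \<one>\<^bsub>A\<^esub>"
  have f: "range ?f \<subseteq> carrier A"
    using a by auto
  have shift: "(\<exists>m. act v x = (act v ^^ Suc m) u) \<longleftrightarrow> x = u \<or> (\<exists>m. x = (act v ^^ Suc m) u)" for x
  proof -
    have "(\<exists>m. act v x = (act v ^^ Suc m) u) \<longleftrightarrow> (\<exists>m. x = (act v ^^ m) u)"
      using inj_act[OF v] by (simp add: inj_eq)
    also have "\<dots> \<longleftrightarrow> x = u \<or> (\<exists>m. x = (act v ^^ Suc m) u)"
      by (metis funpow_0 not0_implies_Suc)
    finally show ?thesis .
  qed
  have "?f (act v x) \<otimes>\<^bsub>A\<^esub> inv\<^bsub>A\<^esub> ?f x = (if x = u then a else \<one>\<^bsub>A\<^esub>)" for x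
    unfolding shift using a u u[symmetric] by (auto simp del: funpow.simps)
  then show ?thesis
    unfolding ray_def delta_def base_conj_top[OF v f] base_inv[OF f] base_mult by presburger
qed

end

subsection \<open>Solvability\<close>

lemma solvable_comm_group:
  assumes "comm_group G" shows "solvable G"
proof -
  interpret comm_group G by fact
  have "(derived G ^^ 1) (carrier G) = {\<one>\<^bsub>G\<^esub>}"
    by (simp add: derived_eq_singleton)
  then show ?thesis
    using solvable_iff_trivial_derived_seq by blast
qed

lemma group_base_power:
  assumes "group A" shows "group (base_power A :: ('w \<Rightarrow> 'a) monoid)"
proof -
  interpret A: group A by fact
  show ?thesis
  proof (rule groupI)
    fix f :: "'w \<Rightarrow> 'a" assume "f \<in> carrier (base_power A)"
    then show "\<exists>g\<in>carrier (base_power A). g \<otimes>\<^bsub>base_power A\<^esub> f = \<one>\<^bsub>base_power A\<^esub>"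
      by (intro bexI[of _ "\<lambda>x. inv\<^bsub>A\<^esub> f x"]) (auto simp: base_power_def range_subsetD)
  qed (auto simp: base_power_def A.m_assoc range_subsetD)
qed

text \<open>Evaluation at a point is a homomorphism to \<open>A\<close>, so it sends the
  \<open>n\<close>-th derived subgroup into that of \<open>A\<close>. One \<open>n\<close> serves
  all coordinates.\<close>

lemma solvable_base_power:
  assumes "group A" "solvable A"
  shows "solvable (base_power A :: ('w \<Rightarrow> 'a) monoid)"
proof -
  interpret A: group A by fact
  interpret B: group "base_power A :: ('w \<Rightarrow> 'a) monoid"
    using group_base_power[OF assms(1)] .
  let ?B = "base_power A :: ('w \<Rightarrow> 'a) monoid"
  obtain n where n: "(derived A ^^ n) (carrier A) = {\<one>\<^bsub>A\<^esub>}"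
    using assms(2) A.solvable_iff_trivial_derived_seq by blast
  have "f x = \<one>\<^bsub>A\<^esub>" if "f \<in> (derived ?B ^^ n) (carrier ?B)" for f x
  proof -
    interpret e: group_hom ?B A "\<lambda>f. f x"
      by unfold_locales (auto simp: hom_def base_power_def)
    have "f x \<in> (derived A ^^ n) ((\<lambda>f. f x) ` carrier ?B)"
      using that e.exp_of_derived_img[of "carrier ?B" n] by auto
    also have "\<dots> \<subseteq> (derived A ^^ n) (carrier A)"
      by (rule A.mono_exp_of_derived) (use e.hom_closed in blast)+
    also have "\<dots> = {\<one>\<^bsub>A\<^esub>}"
      by (rule n)
    finally show ?thesis by simp
  qed
  then have "(derived ?B ^^ n) (carrier ?B) \<subseteq> {\<one>\<^bsub>?B\<^esub>}"
    by (auto simp: base_power_def)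
  moreover have "\<one>\<^bsub>?B\<^esub> \<in> (derived ?B ^^ n) (carrier ?B)"
    using subgroup.one_closed B.exp_of_derived_is_subgroup B.subgroup_self by blast
  ultimately show ?thesis
    using B.solvable_iff_trivial_derived_seq by blast
qed

text \<open>\<open>W\<close> is an extension of \<open>P\<close> by the direct power of
  \<open>A\<close>.\<close>

lemma (in wreath) solvable_W:
  assumes "solvable A" "solvable P"
  shows "solvable W"
proof (rule solvable_condition[OF _ group_hom_snd])
  interpret B: group "base_power A :: ('w \<Rightarrow> 'a) monoid"
    using group_base_power[OF A.group_axioms] .
  show "group_hom (base_power A) W base"
    by unfold_locales (auto simp: hom_def base_closed base_mult, auto simp: base_power_def base_closed)
  show "kernel W P snd \<subseteq> base ` carrier (base_power A)"
    by (auto simp: kernel_snd base_power_def)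
  show "snd ` carrier W = carrier P"
  proof
    show "snd ` carrier W \<subseteq> carrier P"
      by (auto simp: carrier_W)
    show "carrier P \<subseteq> snd ` carrier W"
    proof
      fix p assume "p \<in> carrier P"
      then show "p \<in> snd ` carrier W"
        by (intro image_eqI[of _ _ "top p"] top_closed) (simp add: top_def)
    qed
  qed
qed (use assms solvable_base_power A.group_axioms in auto)

lemma (in group) solvable_subgroup_group:
  assumes "solvable G" "subgroup K G"
  shows "solvable (G\<lparr>carrier := K\<rparr>)"
proof -
  interpret group_hom "G\<lparr>carrier := K\<rparr>" G "\<lambda>x. x"
    using subgroup_imp_group[OF assms(2)] subgroup.subset[OF assms(2)]
    by (simp add: group_hom_def group_hom_axioms_def hom_def group_axioms subset_iff Pi_iff)
  show ?thesis
    using inj_hom_imp_solvable assms(1) by simp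
qed

section \<open>A solvable group separating a word from the identity\<close>

text \<open>Each coordinate is translated by an amount that depends on the earlier ones only. These
  permutations form the \<open>n\<close>-fold iterated unrestricted wreath product of infinite
  cyclic groups, on one type for all \<open>n\<close>.\<close>

definition triangular :: "nat \<Rightarrow> ((nat \<Rightarrow> int) \<Rightarrow> nat \<Rightarrow> int) \<Rightarrow> bool"
  where "triangular n g \<longleftrightarrow> bij g \<and>
    (\<forall>j z z'. (\<forall>i<j. z i = z' i) \<longrightarrow> g z j - z j = g z' j - z' j) \<and> (\<forall>z. \<forall>j\<ge>n. g z j = z j)"

definition triangular_group :: "nat \<Rightarrow> ((nat \<Rightarrow> int) \<Rightarrow> nat \<Rightarrow> int) monoid"
  where "triangular_group n = \<lparr>carrier = Collect (triangular n), monoid.mult = (\<circ>), one = id\<rparr>"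

section \<open>Triangular permutations form a group\<close>

lemma triangular_bij: "triangular n g \<Longrightarrow> bij g"
  by (simp add: triangular_def)

lemma triangular_inv_into: "triangular n g \<Longrightarrow> inv_into UNIV g (g z) = z" "triangular n g \<Longrightarrow> g (inv_into UNIV g z) = z"
  by (simp_all add: triangular_bij bij_is_inj bij_is_surj surj_f_inv_f)

lemma triangular_diff:
  "triangular n g \<Longrightarrow> (\<And>i. i < j \<Longrightarrow> z i = z' i) \<Longrightarrow> g z j - z j = g z' j - z' j"
  unfolding triangular_def by blast

lemma triangular_fixes: "triangular n g \<Longrightarrow> n \<le> j \<Longrightarrow> g z j = z j"
  unfolding triangular_def by blast

text \<open>Once the coordinates below \<open>j\<close> agree, both points have the same
  displacement at \<open>j\<close>, so agreement at \<open>j\<close> carries over in both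
  directions.\<close>

lemma triangular_agree_iff:
  assumes "triangular n g"
  shows "(\<forall>i<j. g z i = g z' i) \<longleftrightarrow> (\<forall>i<j. z i = z' i)"
proof (induction j)
  case (Suc j)
  have "(\<forall>i<j. z i = z' i) \<Longrightarrow> g z j = g z' j \<longleftrightarrow> z j = z' j"
    using triangular_diff[OF assms, of j z z'] by force
  then show ?case
    using Suc by (auto simp: less_Suc_eq)
qed simp

lemma triangular_comp:
  assumes "triangular n g" "triangular n h"
  shows "triangular n (g \<circ> h)"
proof -
  have "g (h z) j - z j = g (h z') j - z' j" if "\<forall>i<j. z i = z' i" for j z z'
  proof -
    have "\<forall>i<j. h z i = h z' i"
      using that triangular_agree_iff[OF assms(2)] by blast
    then show ?thesis
      using that triangular_diff[OF assms(1), of j "h z" "h z'"] triangular_diff[OF assms(2), of j z z']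
      by simp
  qed
  then show ?thesis
    using assms by (auto simp: triangular_def bij_comp)
qed

lemma triangular_inv:
  assumes "triangular n g"
  shows "triangular n (inv_into UNIV g)"
proof -
  have g: "bij g" using assms by (rule triangular_bij)
  have gi: "g (inv_into UNIV g z) = z" for z
    using g by (simp add: bij_is_surj surj_f_inv_f)
  have "inv_into UNIV g z j - z j = inv_into UNIV g z' j - z' j" if "\<forall>i<j. z i = z' i" for j z z'
  proof -
    have "\<forall>i<j. inv_into UNIV g z i = inv_into UNIV g z' i"
      using that triangular_agree_iff[OF assms, of j "inv_into UNIV g z" "inv_into UNIV g z'"] by (simp add: gi)
    then show ?thesis
      using triangular_diff[OF assms, of j "inv_into UNIV g z" "inv_into UNIV g z'"] by (simp add: gi)
  qed
  moreover have "inv_into UNIV g z j = z j" if "n \<le> j" for z j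
    using triangular_fixes[OF assms that, of "inv_into UNIV g z"] by (simp add: gi)
  ultimately show ?thesis
    using g by (auto simp: triangular_def bij_imp_bij_inv)
qed

lemma group_triangular_group: "group (triangular_group n)"
proof (rule groupI)
  fix g assume "g \<in> carrier (triangular_group n)"
  then show "\<exists>h\<in>carrier (triangular_group n). h \<otimes>\<^bsub>triangular_group n\<^esub> g = \<one>\<^bsub>triangular_group n\<^esub>"
    by (intro bexI[of _ "inv_into UNIV g"])
      (auto simp: triangular_group_def triangular_inv triangular_inv_into fun_eq_iff)
qed (auto simp: triangular_group_def triangular_comp comp_assoc, simp add: triangular_def)

lemma inv_triangular_group:
  "triangular n g \<Longrightarrow> inv\<^bsub>triangular_group n\<^esub> g = inv_into UNIV g"
  by (rule group.inv_equality[OF group_triangular_group])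
    (auto simp: triangular_group_def triangular_inv triangular_inv_into fun_eq_iff)

text \<open>Let \<open>D k\<close> fix the first \<open>k\<close> coordinates. On coordinate
  \<open>k\<close> its elements act by translations that do not disturb one another, so commutators
  lie in \<open>D (Suc k)\<close>; and \<open>D n\<close> is trivial.\<close>

lemma solvable_triangular_group: "solvable (triangular_group n)"
proof -
  let ?T = "triangular_group n"
  interpret T: group ?T by (rule group_triangular_group)
  define D where "D k = {g. triangular n g \<and> (\<forall>z. \<forall>j<k. g z j = z j)}" for k
  have D: "subgroup (D k) ?T" for k
  proof (rule T.subgroupI)
    have "id \<in> D k"
      using T.one_closed by (simp add: D_def triangular_group_def)
    then show "D k \<noteq> {}" by blast
    fix g assume g: "g \<in> D k"
    then have "inv_into UNIV g z j = z j" if "j < k" for z j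
      using that unfolding D_def
      by (metis (mono_tags, lifting) bij_is_surj mem_Collect_eq surj_f_inv_f triangular_bij)
    then show "inv\<^bsub>?T\<^esub> g \<in> D k"
      using g by (simp add: D_def inv_triangular_group triangular_inv)
  qed (auto simp: D_def triangular_group_def triangular_comp)
  have der: "derived ?T (D k) \<subseteq> D (Suc k)" for k
    unfolding derived_def
  proof (rule T.generate_subgroup_incl[OF _ D], clarify)
    fix a b assume ab: "a \<in> D k" "b \<in> D k"
    then have T: "triangular n a" "triangular n b" by (simp_all add: D_def)
    let ?c = "a \<otimes>\<^bsub>?T\<^esub> b \<otimes>\<^bsub>?T\<^esub> inv\<^bsub>?T\<^esub> a \<otimes>\<^bsub>?T\<^esub> inv\<^bsub>?T\<^esub> b"
    have c: "?c \<in> D k"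
      using ab D by (intro subgroup.m_closed[OF D] subgroup.m_inv_closed[OF D])
    have "?c u k = u k" for u
    proof -
      \<comment> \<open>Starting from \<open>z\<close> removes the inverses: \<open>a (b z)\<close>
        and \<open>b (a z)\<close> have to agree at \<open>k\<close>.\<close>
      define z where "z = inv_into UNIV a (inv_into UNIV b u)"
      have z: "u = b (a z)" "?c u = a (b z)"
        using T by (simp_all add: z_def inv_triangular_group triangular_bij bij_is_surj surj_f_inv_f)
          (simp add: triangular_group_def)
      \<comment> \<open>Neither \<open>a\<close> nor \<open>b\<close> changes the coordinates below
        \<open>k\<close>, on which both displacements depend.\<close>
      have "a (b z) k - b z k = a z k - z k" "b (a z) k - a z k = b z k - z k"
        using ab by (auto simp: D_def intro!: triangular_diff[of n])
      then show ?thesis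
        using z by simp
    qed
    then show "?c \<in> D (Suc k)"
      using c by (auto simp: D_def less_Suc_eq)
  qed
  have "(derived ?T ^^ k) (carrier ?T) \<subseteq> D k" for k
  proof (induction k)
    case 0
    then show ?case by (auto simp: D_def triangular_group_def)
  next
    case (Suc k)
    then show ?case
      using T.mono_derived[OF Suc] der[of k] by auto
  qed
  moreover have "D n \<subseteq> {\<one>\<^bsub>?T\<^esub>}"
  proof
    fix g assume g: "g \<in> D n"
    have "g z j = z j" for z j
      using g triangular_fixes[of n g j z] by (cases "j < n") (auto simp: D_def)
    then show "g \<in> {\<one>\<^bsub>?T\<^esub>}"
      by (simp add: triangular_group_def fun_eq_iff)
  qed
  moreover have "\<one>\<^bsub>?T\<^esub> \<in> (derived ?T ^^ n) (carrier ?T)"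
    using subgroup.one_closed T.exp_of_derived_is_subgroup T.subgroup_self by blast
  ultimately show ?thesis
    using T.solvable_iff_trivial_derived_seq by blast
qed

text \<open>
  The displacement of the first coordinate that \<open>v\<close> moves depends only on earlier coordinates,
  so every application of \<open>v\<close> adds the same amount.
\<close>
lemma triangular_infinite_orbit:
  assumes v: "triangular n v" and "v \<noteq> id"
  shows "\<exists>u. \<forall>m. (v ^^ Suc m) u \<noteq> u"
proof -
  have "\<exists>j u. v u j \<noteq> u j"
    using assms(2) by (force simp: fun_eq_iff)
  then obtain j where j: "\<exists>u. v u j \<noteq> u j" and min: "\<And>i z. i < j \<Longrightarrow> v z i = z i"
    using exists_least_iff[of "\<lambda>j. \<exists>u. v u j \<noteq> u j"] by blast
  from j obtain u where u: "v u j \<noteq> u j" by blast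
  have "(\<forall>i<j. (v ^^ m) u i = u i) \<and> (v ^^ m) u j = u j + int m * (v u j - u j)" for m
  proof (induction m)
    case (Suc m)
    then have "v ((v ^^ m) u) j - (v ^^ m) u j = v u j - u j"
      by (intro triangular_diff[OF v]) auto
    then show ?case
      using Suc min by (simp add: algebra_simps)
  qed simp
  then have "(v ^^ Suc m) u j \<noteq> u j" for m
    using u by (simp del: funpow.simps)
  then show ?thesis
    by metis
qed

text \<open>The points visited while the word acts, with the starting point last because the
  rightmost letter acts first. An inverse letter is the step of its generator read backwards, which
  avoids inverse functions.\<close>

fun word_path :: "(nat \<Rightarrow> 'p \<Rightarrow> 'p) \<Rightarrow> letter list \<Rightarrow> 'p list \<Rightarrow> bool" where
  "word_path x [] [y] \<longleftrightarrow> True"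
| "word_path x (a # w) (y' # y # ys) \<longleftrightarrow>
     (if snd a then x (fst a) y = y' else x (fst a) y' = y) \<and> word_path x w (y # ys)"
| "word_path x _ _ \<longleftrightarrow> False"

lemma length_word_path: "word_path x w ys \<Longrightarrow> length ys = Suc (length w)"
  by (induction x w ys rule: word_path.induct) auto

text \<open>A path uses a generator only at points of the path whose images lie on the path too, so
  generators may be altered elsewhere.\<close>

lemma word_path_cong:
  assumes "word_path x w ys" "\<And>i y. y \<in> set ys \<Longrightarrow> x i y \<in> set ys \<Longrightarrow> x' i y = x i y"
  shows "word_path x' w ys"
  using assms by (induction x w ys rule: word_path.induct) auto

lemma word_value_word_path:
  assumes "word_path x w ys" "\<And>i. triangular n (x i)"
  shows "word_value (triangular_group n) x w (last ys) = hd ys"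
proof -
  interpret T: group "triangular_group n" by (rule group_triangular_group)
  have "word_value (triangular_group n) x [] y = y" for y
    unfolding T.word_value_Nil by (simp add: triangular_group_def)
  moreover have "word_value (triangular_group n) x (a # w) y =
      (if snd a then x (fst a) else inv_into UNIV (x (fst a))) (word_value (triangular_group n) x w y)" for a w y
    unfolding T.word_value_Cons using assms(2)
    by (simp add: letter_value_def inv_triangular_group) (simp add: triangular_group_def)
  ultimately show ?thesis
    using assms(1)
  proof (induction w arbitrary: ys)
    case Nil
    then show ?case
      using length_word_path[OF Nil.prems(3)] by (cases ys) auto
  next
    case (Cons a w)
    then obtain y' y ys' where ys: "ys = y' # y # ys'"
      using length_word_path[OF Cons.prems(3)] by (metis length_Suc_conv)
    then have "word_value (triangular_group n) x w (last (y # ys')) = y"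
      using Cons by (metis list.sel(1) word_path.simps(2))
    then show ?case
      using Cons.prems(3) triangular_inv_into(1)[OF assms(2), of "fst a" y'] unfolding ys Cons.prems(2)
      by (auto split: if_splits)
  qed
qed

section \<open>Adding one coordinate to triangular permutations\<close>

lemma triangular_Suc: "triangular n g \<Longrightarrow> triangular (Suc n) g"
  by (auto simp: triangular_def)

text \<open>Coordinate \<open>n\<close> is neither read nor changed by \<open>g\<close>, so it can
  serve as a mark for a new point.\<close>

lemma triangular_fun_upd:
  assumes "triangular n g"
  shows "g (z(n := t)) = (g z)(n := t)"
proof
  fix j
  show "g (z(n := t)) j = ((g z)(n := t)) j"
  proof (cases "j < n")
    case True
    then show ?thesis
      using triangular_diff[OF assms, of j "z(n := t)" z] by simp
  next
    case False
    then show ?thesis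
      using triangular_fixes[OF assms] by simp
  qed
qed

text \<open>The condition reads only coordinates that the map leaves alone, so subtracting
  \<open>d\<close> under the same condition inverts it.\<close>

lemma triangular_bump:
  "triangular (Suc n) (\<lambda>z. z(n := z n + (if \<forall>j<n. z j = c j then d else 0)))" (is "triangular _ ?e")
proof -
  let ?e' = "\<lambda>z. z(n := z n - (if \<forall>j<n. z j = c j then d else 0))"
  have "bij ?e"
    by (rule o_bij[of ?e']) (auto simp: fun_eq_iff)
  then show ?thesis
    by (auto simp: triangular_def)
qed

text \<open>
  Points along the path are kept distinct by giving every new letter its own coordinate: its
  generator bumps that coordinate at a single point \<open>c\<close>, and since the word is reduced, no
  earlier step of the path involves the value of this generator at \<open>c\<close>.
\<close>
lemma reduced_word_path:
  assumes "reduced w"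
  shows "\<exists>x ys. (\<forall>i. triangular (length w) (x i)) \<and> word_path x w ys \<and> distinct ys \<and>
    (\<forall>y\<in>set ys. \<forall>j\<ge>length w. y j = 0)"
  using assms
proof (induction w)
  case Nil
  have "triangular 0 (\<lambda>y. y)"
    by (simp add: triangular_def bij_id[unfolded id_def])
  then show ?case
    by (intro exI[of _ "\<lambda>_ y. y"] exI[of _ "[\<lambda>_. 0]"]) simp
next
  case (Cons a w)
  define n where "n = length w"
  obtain i s where a: "a = (i, s)" by (cases a)
  obtain x ys where "\<forall>i. triangular n (x i)" and path: "word_path x w ys" and dist: "distinct ys"
      and "\<forall>y\<in>set ys. \<forall>j\<ge>n. y j = 0"
    using Cons unfolding n_def reduced_Cons by blast
  then have x: "triangular n (x i)" and zero: "y \<in> set ys \<Longrightarrow> n \<le> j \<Longrightarrow> y j = 0" for i y j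
    by blast+
  obtain y ys' where ys: "ys = y # ys'"
    using length_word_path[OF path] by (cases ys) auto
  \<comment> \<open>The point at which \<open>x i\<close> is used by the new step: the head
    \<open>y\<close> for a generator, the preimage of \<open>y\<close> for an inverse
    letter.\<close>
  define c where "c = (if s then y else inv_into UNIV (x i) y)"
  \<comment> \<open>A generator creates the mark 1 in coordinate \<open>n\<close>; for an inverse
    letter the generator runs from the new point back to \<open>y\<close> and has to erase
    it.\<close>
  define d :: int where "d = (if s then 1 else -1)"
  define e where "e = (\<lambda>z. z(n := z n + (if \<forall>j<n. z j = c j then d else 0)))"
  define x' where "x' = x(i := x i \<circ> e)"
  \<comment> \<open>The mark separates \<open>y'\<close> from all earlier points, which vanish at
    \<open>n\<close>.\<close>
  define y' where "y' = (if s then x i y else c)(n := 1)"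
  have xc: "x i c = y" if "\<not> s"
    using that triangular_inv_into(2)[OF x] by (simp add: c_def)
  have zc: "c j = 0" if "n \<le> j" for j
  proof (cases s)
    case False
    then show ?thesis
      using triangular_fixes[OF x[of i] that, of c] xc zero[of y] that ys by simp
  qed (use zero that ys in \<open>simp add: c_def\<close>)
  have x': "triangular (Suc n) (x' k)" for k
    using x triangular_comp[OF triangular_Suc triangular_bump]
    by (auto simp: x'_def e_def triangular_Suc)
  have old: "x' k q = x k q" if q: "q \<in> set ys" and "k = i \<Longrightarrow> q \<noteq> c" for k q
  proof (cases "k = i")
    case True
    \<comment> \<open>Both \<open>q\<close> and \<open>c\<close> vanish from coordinate
      \<open>n\<close> on, so they differ below \<open>n\<close> and \<open>e\<close> fixes
      \<open>q\<close>.\<close>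
    have "\<exists>j<n. q j \<noteq> c j"
    proof (rule ccontr)
      assume "\<not> ?thesis"
      then have "q j = c j" for j
        using zero[OF q] zc by (cases "j < n") auto
      then show False
        using that(2)[OF True] by blast
    qed
    then have "e q = q"
      by (auto simp: e_def)
    then show ?thesis
      using True by (simp add: x'_def)
  qed (simp add: x'_def)
  have step: "if s then x' i y = y' else x' i y' = y"
  proof (cases s)
    case True
    then show ?thesis
      using triangular_fun_upd[OF x, of i y 1] zero[of y n] ys
      by (simp add: x'_def e_def c_def d_def y'_def)
  next
    case False
    then have "e y' = c"
      using zc by (auto simp: e_def d_def y'_def)
    then show ?thesis
      using False xc by (simp add: x'_def)
  qed
  have "word_path x' w ys"
  proof (cases w)
    case Nil
    then show ?thesis
      using path ys by (cases ys') auto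
  next
    case (Cons b w')
    then obtain y1 ys'' where ys': "ys' = y1 # ys''"
      using path ys by (cases ys') auto
    \<comment> \<open>By distinctness \<open>y\<close> is not in \<open>ys'\<close>, and either
      \<open>c\<close> or \<open>x i c\<close> equals \<open>y\<close>.\<close>
    have c: "q \<noteq> c" if "q \<in> set ys'" "x i q \<in> set ys'" for q
      using that dist ys xc by (auto simp: c_def)
    have "word_path x' w' ys'"
    proof (rule word_path_cong)
      show "word_path x w' ys'"
        using path ys ys' Cons by simp
      show "x' k q = x k q" if "q \<in> set ys'" "x k q \<in> set ys'" for k q
        using that c old[of q k] ys by auto
    qed
    \<comment> \<open>Reducedness enters here: if \<open>b\<close> has the same generator as
      \<open>a\<close>, it has the same sign. The step between \<open>y1\<close> and
      \<open>y\<close> then uses this generator at a point other than \<open>c\<close>.\<close>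
    moreover have "b \<noteq> inv_letter a"
      using \<open>reduced (a # w)\<close> Cons by (simp add: reduced_Cons)
    then have b: "snd b = s" if "fst b = i"
      using that by (cases b) (auto simp: a inv_letter_def)
    have "if snd b then x' (fst b) y1 = y else x' (fst b) y = y1"
    proof (cases "snd b")
      case True
      then have "fst b = i \<Longrightarrow> y1 \<noteq> c"
        using b dist ys ys' by (auto simp: c_def)
      then show ?thesis
        using old[of y1 "fst b"] path ys ys' Cons True by simp
    next
      case False
      then have "fst b = i \<Longrightarrow> y \<noteq> c"
        using b dist ys ys' xc path Cons by auto
      then show ?thesis
        using old[of y "fst b"] path ys ys' Cons False by simp
    qed
    ultimately show ?thesis
      using Cons ys ys' by simp
  qed
  then have "word_path x' (a # w) (y' # ys)"
    using step ys a by simp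
  moreover have "y' n = 1"
    by (simp add: y'_def)
  then have "distinct (y' # ys)"
    using dist zero by force
  moreover have "z j = 0" if "z \<in> set (y' # ys)" "Suc n \<le> j" for z j
    using that zero zc triangular_fixes[OF x, of j i y] ys by (auto simp: y'_def)
  ultimately show ?case
    using x' unfolding n_def by (metis length_Cons)
qed

text \<open>The path of a non-empty reduced word has distinct ends, and the value of the word maps
  one to the other.\<close>

lemma word_value_triangular_neq_one:
  assumes "reduced w" "w \<noteq> []"
  shows "\<exists>n x. range x \<subseteq> carrier (triangular_group n) \<and>
    word_value (triangular_group n) x w \<noteq> \<one>\<^bsub>triangular_group n\<^esub>"
proof -
  define n where "n = length w"
  obtain x ys where x: "\<forall>i. triangular n (x i)" and path: "word_path x w ys" and "distinct ys"
    using reduced_word_path[OF assms(1)] unfolding n_def by blast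
  have len: "length ys = Suc (length w)"
    by (rule length_word_path[OF path])
  obtain y ys' where "ys = y # ys'"
    using len by (cases ys) auto
  moreover from this have "ys' \<noteq> []"
    using len assms(2) by auto
  ultimately have "hd ys \<noteq> last ys"
    using \<open>distinct ys\<close> by auto
  then have "word_value (triangular_group n) x w \<noteq> id"
    using word_value_word_path[OF path, of n] x by (metis id_apply)
  then show ?thesis
    using x by (intro exI[of _ n] exI[of _ x]) (auto simp: triangular_group_def)
qed

section \<open>Cardinality of generated subgroups\<close>

lemma infinite_times_lepoll:
  assumes "infinite C" "A \<lesssim> C" "B \<lesssim> C"
  shows "A \<times> B \<lesssim> C"
proof -
  have "|C \<times> C| \<le>o |C|"
    using card_of_Times_same_infinite[OF assms(1)] ordIso_iff_ordLeq by blast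
  then have "C \<times> C \<lesssim> C"
    unfolding lepoll_def card_of_ordLeq .
  then show ?thesis
    using times_lepoll_mono[OF assms(2,3)] lepoll_trans by blast
qed

lemma infinite_Un_lepoll:
  assumes "infinite C" "A \<lesssim> C" "B \<lesssim> C"
  shows "A \<union> B \<lesssim> C"
proof -
  obtain g h where "A \<subseteq> g ` C" "B \<subseteq> h ` C"
    using assms(2,3) unfolding lepoll_iff by blast
  moreover have "g ` C \<subseteq> (\<lambda>(b, c). if b then g c else h c) ` (UNIV \<times> C)"
    by (rule image_subsetI, rule image_eqI[where x = "(True, _)"]) simp_all
  moreover have "h ` C \<subseteq> (\<lambda>(b, c). if b then g c else h c) ` (UNIV \<times> C)"
    by (rule image_subsetI, rule image_eqI[where x = "(False, _)"]) simp_all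
  ultimately have "A \<union> B \<subseteq> (\<lambda>(b, c). if b then g c else h c) ` (UNIV \<times> C)"
    by blast
  then have "A \<union> B \<lesssim> (UNIV :: bool set) \<times> C"
    by (rule subset_image_lepoll)
  also have "\<dots> \<lesssim> C"
    using assms(1) by (intro infinite_times_lepoll) (auto intro: finite_lepoll_infinite)
  finally show ?thesis .
qed

text \<open>A list is coded by its length and the iterated pairing of its entries, ending in a fixed
  \<open>a\<close>; the length makes the decoding unambiguous.\<close>

lemma infinite_lists_lepoll:
  assumes "infinite A"
  shows "lists A \<lesssim> A"
proof -
  obtain h where h: "inj_on h (A \<times> A)" "h ` (A \<times> A) \<subseteq> A"
    using infinite_times_lepoll[OF assms lepoll_refl lepoll_refl] unfolding lepoll_def by blast
  obtain a where a: "a \<in> A"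
    using assms by fastforce
  define enc where "enc = foldr (\<lambda>x y. h (x, y)) "
  have enc_A: "enc xs a \<in> A" if "xs \<in> lists A" for xs
    using that h(2) a by (induction xs) (auto simp: enc_def)
  have enc_inj: "length xs = length ys \<Longrightarrow> xs \<in> lists A \<Longrightarrow> ys \<in> lists A \<Longrightarrow> enc xs a = enc ys a \<Longrightarrow> xs = ys"
    for xs ys
  proof (induction xs ys rule: list_induct2)
    case (Cons x xs y ys)
    then have "h (x, enc xs a) = h (y, enc ys a)"
      by (simp add: enc_def)
    then have "(x, enc xs a) = (y, enc ys a)"
      using Cons.prems enc_A by (intro inj_onD[OF h(1)]) auto
    then show ?case
      using Cons by auto
  qed simp
  have "inj_on (\<lambda>xs. (length xs, enc xs a)) (lists A)"
    by (rule inj_onI) (use enc_inj in auto)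
  then have "lists A \<lesssim> (UNIV :: nat set) \<times> A"
    unfolding lepoll_def using enc_A by (intro exI conjI image_subsetI) auto
  also have "\<dots> \<lesssim> A"
    using assms infinite_le_lepoll by (intro infinite_times_lepoll) auto
  finally show ?thesis .
qed

text \<open>Every element is the product of a list of generators with signs, and an infinite
  \<open>A\<close> absorbs both signs and lists.\<close>

lemma (in group) generate_lepoll:
  assumes "infinite A" "S \<subseteq> carrier G" "S \<lesssim> A"
  shows "generate G S \<lesssim> A"
proof -
  define letter where "letter = (\<lambda>(s, b). if b then s else inv s)"
  define letters_prod where "letters_prod xs = foldr (\<lambda>a g. letter a \<otimes> g) xs \<one>" for xs
  have letter: "letter a \<in> carrier G" if "a \<in> S \<times> UNIV" for a
    using that assms(2) by (auto simp: letter_def)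
  have letters_prod: "letters_prod xs \<in> carrier G" if "xs \<in> lists (S \<times> UNIV)" for xs
    using that by (induction xs) (auto simp: letters_prod_def letter)
  have append: "letters_prod xs \<otimes> letters_prod ys = letters_prod (xs @ ys)"
    if "xs \<in> lists (S \<times> UNIV)" "ys \<in> lists (S \<times> UNIV)" for xs ys
    using that(1)
  proof (induction xs)
    case Nil
    then show ?case
      using letters_prod[OF that(2)] by (simp add: letters_prod_def)
  next
    case (Cons a xs)
    then have "letters_prod (a # xs) \<otimes> letters_prod ys = letter a \<otimes> (letters_prod xs \<otimes> letters_prod ys)"
      using letters_prod[OF that(2)] letters_prod[of xs] letter[of a] by (simp add: letters_prod_def m_assoc)
    then show ?case
      using Cons by (simp add: letters_prod_def)
  qed
  have "generate G S \<subseteq> letters_prod ` lists (S \<times> UNIV)"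
  proof
    fix g assume "g \<in> generate G S"
    then show "g \<in> letters_prod ` lists (S \<times> UNIV)"
    proof induction
      case one
      show ?case
        by (rule image_eqI[of _ _ "[]"]) (auto simp: letters_prod_def)
    next
      case (incl h)
      then show ?case
        using assms(2) by (intro image_eqI[of _ _ "[(h, True)]"]) (auto simp: letters_prod_def letter_def)
    next
      case (inv h)
      then show ?case
        using assms(2) by (intro image_eqI[of _ _ "[(h, False)]"]) (auto simp: letters_prod_def letter_def)
    next
      case (eng h1 h2)
      then obtain xs ys where "xs \<in> lists (S \<times> UNIV)" "h1 = letters_prod xs" "ys \<in> lists (S \<times> UNIV)" "h2 = letters_prod ys"
        by (elim imageE)
      then show ?case
        by (intro image_eqI[of _ _ "xs @ ys"]) (simp_all add: append)
    qed
  qed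
  then have "generate G S \<lesssim> lists (S \<times> (UNIV :: bool set))"
    by (rule subset_image_lepoll)
  also have "\<dots> \<lesssim> lists A"
    using assms finite_lepoll_infinite[of A "UNIV :: bool set"]
    by (intro lists_lepoll_mono infinite_times_lepoll) auto
  also have "\<dots> \<lesssim> A"
    by (rule infinite_lists_lepoll[OF assms(1)])
  finally show ?thesis .
qed

section \<open>Embedding into a verbal subgroup\<close>

text \<open>Following \<open>\<phi>\<close> by conjugation with \<open>c\<close> gives another
  homomorphism, so the commutator is the quotient of two values of \<open>w\<close>.\<close>

lemma (in group) commutator_mem_verbal_subgroup:
  assumes "\<phi> \<in> hom F\<^sub>\<infinity> G" "w \<in> V" "w \<in> carrier F\<^sub>\<infinity>" "c \<in> carrier G"
  shows "inv (\<phi> w) \<otimes> c \<otimes> \<phi> w \<otimes> inv c \<in> verbal_subgroup V G"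
proof -
  let ?\<psi> = "\<lambda>u. c \<otimes> \<phi> u \<otimes> inv c"
  have \<phi>: "\<phi> u \<in> carrier G" if "u \<in> carrier F\<^sub>\<infinity>" for u
    using assms(1) that by (auto simp: hom_def)
  have "?\<psi> \<in> hom F\<^sub>\<infinity> G"
  proof (rule homI)
    fix u v assume uv: "u \<in> carrier F\<^sub>\<infinity>" "v \<in> carrier F\<^sub>\<infinity>"
    have "?\<psi> u \<otimes> ?\<psi> v = c \<otimes> \<phi> u \<otimes> (inv c \<otimes> c) \<otimes> \<phi> v \<otimes> inv c"
      using \<phi>[OF uv(1)] \<phi>[OF uv(2)] assms(4) by (simp only: m_assoc m_closed inv_closed)
    then show "?\<psi> (u \<otimes>\<^bsub>F\<^sub>\<infinity>\<^esub> v) = ?\<psi> u \<otimes> ?\<psi> v"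
      using \<phi>[OF uv(1)] \<phi>[OF uv(2)] assms(4) hom_mult[OF assms(1) uv] by (simp add: m_assoc)
  qed (use assms(4) \<phi> in simp)
  then have "\<phi> w \<in> {\<phi> w |\<phi> w. \<phi> \<in> hom F\<^sub>\<infinity> G \<and> w \<in> V}" "?\<psi> w \<in> {\<phi> w |\<phi> w. \<phi> \<in> hom F\<^sub>\<infinity> G \<and> w \<in> V}"
    using assms(1,2) by (auto simp only: mem_Collect_eq)
  then have "inv (\<phi> w) \<otimes> ?\<psi> w \<in> verbal_subgroup V G"
    unfolding verbal_subgroup_def by (intro generate.eng generate.inv generate.incl)
  then show ?thesis
    using \<phi>[OF assms(3)] assms(4) by (simp add: m_assoc)
qed

text \<open>A homomorphism from the free group is determined by its values on the generators, so
  word values computed in \<open>K\<close> and in \<open>G\<close> agree.\<close>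

lemma (in group) subgroup_word_value_hom:
  assumes K: "subgroup K G" and x: "range x \<subseteq> K"
  shows "\<exists>\<phi>\<in>hom F\<^sub>\<infinity> (G\<lparr>carrier := K\<rparr>). \<forall>w\<in>carrier F\<^sub>\<infinity>. \<phi> w = word_value G x w"
proof
  interpret K: group "G\<lparr>carrier := K\<rparr>"
    using K subgroup_imp_group by blast
  let ?\<phi> = "word_value (G\<lparr>carrier := K\<rparr>) x"
  show \<phi>: "?\<phi> \<in> hom F\<^sub>\<infinity> (G\<lparr>carrier := K\<rparr>)"
    using x by (intro K.word_value_hom) simp
  have "?\<phi> \<in> hom F\<^sub>\<infinity> G"
    using \<phi> subgroup.subset[OF K] by (auto simp: hom_def)
  from hom_free_group_inf_unique[OF this] K.word_value_generator[of x] x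
  show "\<forall>w\<in>carrier F\<^sub>\<infinity>. ?\<phi> w = word_value G x w"
    by (simp del: K.word_value_Cons)
qed

lemma (in group_hom) word_value_image:
  assumes "range x \<subseteq> carrier G" "w \<in> carrier F\<^sub>\<infinity>"
  shows "h (word_value G x w) = word_value H (h \<circ> x) w"
proof -
  have "h \<circ> word_value G x \<in> hom F\<^sub>\<infinity> H"
    using G.word_value_hom[OF assms(1)] homh Group.hom_compose by blast
  from H.hom_free_group_inf_unique[OF this assms(2)] show ?thesis
    using G.word_value_generator[OF assms(1)] by (simp add: comp_def)
qed

text \<open>The full wreath product of \<open>H\<close> with a triangular group may be too large, so
  \<open>G\<close> is a subgroup generated by few elements.\<close>

lemma verbal_embedding:
  fixes H :: "('a, 'b) monoid_scheme"
  assumes H: "group H" "infinite (carrier H)"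
    and w: "w \<in> V" "w \<in> carrier F\<^sub>\<infinity>" "w \<noteq> \<one>\<^bsub>F\<^sub>\<infinity>\<^esub>"
  shows "\<exists>G :: (((nat \<Rightarrow> int) \<Rightarrow> 'a) \<times> ((nat \<Rightarrow> int) \<Rightarrow> nat \<Rightarrow> int)) monoid.
    group G \<and> carrier G \<lesssim> carrier H \<and> subnormal_verbal_embedding V H G \<and> (solvable H \<longrightarrow> solvable G)"
proof -
  obtain n x where x: "range x \<subseteq> carrier (triangular_group n)"
    and neq: "word_value (triangular_group n) x w \<noteq> \<one>\<^bsub>triangular_group n\<^esub>"
    using word_value_triangular_neq_one[of w] w by (auto simp: free_group_inf_def)
  let ?T = "triangular_group n"
  interpret T: group ?T by (rule group_triangular_group)
  interpret H: group H by (rule H(1))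
  interpret wreath H ?T "\<lambda>g. g"
    by unfold_locales (auto simp: triangular_group_def)
  define v where "v = word_value ?T x w"
  have v: "v \<in> carrier ?T"
    unfolding v_def by (rule T.word_value_closed[OF x])
  then obtain u where u: "\<And>m. (v ^^ Suc m) u \<noteq> u"
    using triangular_infinite_orbit[of n v] neq by (auto simp: triangular_group_def v_def)
  \<comment> \<open>The elements \<open>top (x i)\<close> make \<open>top v\<close> a value of
    \<open>w\<close> inside \<open>K\<close> itself; the rays supply the commutators
    \<open>delta u a\<close>.\<close>
  define S where "S = range (top \<circ> x) \<union> ray v u ` carrier H"
  define K where "K = generate W S"
  let ?G = "W\<lparr>carrier := K\<rparr>"
  have S: "S \<subseteq> carrier W"
    using x top_closed ray_closed by (auto simp: S_def)
  have K: "subgroup K W"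
    unfolding K_def by (rule W.generate_is_subgroup[OF S])
  interpret G: group ?G
    by (rule W.subgroup_imp_group[OF K])
  have SK: "S \<subseteq> K"
    unfolding K_def by (auto intro: generate.incl)
  obtain \<phi> where \<phi>: "\<phi> \<in> hom F\<^sub>\<infinity> ?G" "\<phi> w = word_value W (top \<circ> x) w"
    using W.subgroup_word_value_hom[OF K, of "top \<circ> x"] SK w(2) by (auto simp: S_def)
  then have \<phi>w: "\<phi> w = top v"
    using group_hom.word_value_image[OF group_hom_top x w(2)] by (simp add: v_def)
  have topK: "top v \<in> K"
    unfolding \<phi>w[symmetric] using \<phi>(1) w(2) by (auto simp: hom_def)
  have rayK: "ray v u a \<in> K" if "a \<in> carrier H" for a
    using SK that by (auto simp: S_def)
  have verbal: "delta u ` carrier H \<subseteq> verbal_subgroup V ?G"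
  proof (rule image_subsetI)
    fix a assume a: "a \<in> carrier H"
    then show "delta u a \<in> verbal_subgroup V ?G"
      using G.commutator_mem_verbal_subgroup[OF \<phi>(1) w(1,2), of "ray v u a"]
        commutator_ray[OF v u a] topK rayK K by (simp add: \<phi>w W.m_inv_consistent)
  qed
  have dK: "delta u ` carrier H \<subseteq> K"
  proof (rule image_subsetI)
    fix a assume a: "a \<in> carrier H"
    show "delta u a \<in> K"
      unfolding commutator_ray[OF v u a, symmetric] using topK rayK[OF a]
      by (intro subgroup.m_closed[OF K] subgroup.m_inv_closed[OF K])
  qed
  have "delta u \<in> iso H (?G\<lparr>carrier := delta u ` carrier H\<rparr>)"
    using group_hom.homh[OF group_hom_delta, of u] inj_on_subset[OF inj_delta]
    by (auto simp: iso_def bij_betw_def hom_def)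
  then have "(?G\<lparr>carrier := delta u ` carrier H\<rparr>) \<cong> H"
    using H.iso_sym is_isoI by blast
  then have "subnormal_verbal_embedding V H ?G"
    unfolding subnormal_verbal_embedding_def
    using W.subnormal_Int[OF subnormal_delta K dK] verbal by blast
  moreover have "K \<lesssim> carrier H"
    unfolding K_def
  proof (rule W.generate_lepoll[OF H(2) S])
    have "range (top \<circ> x) \<lesssim> carrier H"
      using lepoll_trans[OF image_lepoll] H(2) infinite_le_lepoll by blast
    then show "S \<lesssim> carrier H"
      unfolding S_def by (intro infinite_Un_lepoll H(2) image_lepoll)
  qed
  moreover have "solvable H \<longrightarrow> solvable ?G"
    using W.solvable_subgroup_group[OF _ K] solvable_W solvable_triangular_group by blast
  ultimately show ?thesis
    using G.group_axioms by (intro exI[of _ ?G]) simp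
qed

section \<open>Embedding a countable group into a two-generated group\<close>

lemma countable_embedding:
  fixes A :: "('a, 'b) monoid_scheme"
  assumes A: "group A" "countable (carrier A)"
  shows "\<exists>(G :: ((int \<Rightarrow> (int \<Rightarrow> 'a) \<times> int) \<times> int) monoid) h.
    group_hom A G h \<and> inj_on h (carrier A) \<and> subnormal (h ` carrier A) G \<and>
    countable (carrier G) \<and> two_generated G \<and> (solvable A \<longrightarrow> solvable G)"
proof -
  interpret A: group A by (rule A(1))
  obtain f :: "nat \<Rightarrow> 'a" where f: "range f = carrier A"
    using range_from_nat_into[OF _ A(2)] A.one_closed by blast
  interpret Z: group integer_group
    by (rule group_integer_group)
  interpret W1: wreath A integer_group "(+)"
    by unfold_locales auto
  interpret W2: wreath W1.W integer_group "(+)"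
    by unfold_locales auto
  \<comment> \<open>For the translation by 1 the ray from 0 is the set of positive integers. At
    \<open>n = 2 * i + 1\<close> the index \<open>nat n div 2\<close> is \<open>i\<close>.\<close>
  define \<psi> where "\<psi> n = (if n = 0 then W1.top 1 else if 0 < n \<and> odd n then W1.ray 1 0 (f (nat n div 2))
    else \<one>\<^bsub>W1.W\<^esub>)" for n :: int
  have \<psi>: "range \<psi> \<subseteq> carrier W1.W"
    using f by (auto simp: \<psi>_def intro!: W1.top_closed W1.ray_closed)
  define b t where "b = W2.base \<psi>" and "t = W2.top 1"
  define K where "K = generate W2.W {b, t}"
  let ?G = "W2.W\<lparr>carrier := K\<rparr>"
  have bt: "{b, t} \<subseteq> carrier W2.W"
    using W2.base_closed[OF \<psi>] W2.top_closed by (simp add: b_def t_def)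
  have K: "subgroup K W2.W"
    unfolding K_def by (rule W2.W.generate_is_subgroup[OF bt])
  interpret G: group ?G
    by (rule W2.W.subgroup_imp_group[OF K])
  have btK: "b \<in> K" "t \<in> K"
    unfolding K_def by (auto intro: generate.incl)
  have top: "W2.top (int m) \<in> K" for m
  proof (induction m)
    case 0
    then show ?case
      using subgroup.one_closed[OF K] by (simp add: W2.top_def W2.one_W)
  next
    case (Suc m)
    then have "W2.top (int m) \<otimes>\<^bsub>W2.W\<^esub> t \<in> K"
      by (intro subgroup.m_closed[OF K] btK)
    then show ?case
      using hom_mult[OF W2.top_hom, of "int m" 1] by (simp add: t_def add.commute)
  qed
  have unit: "((+) (1::int) ^^ m) 0 = int m" for m
    by (induction m) auto
  let ?h = "\<lambda>a. W2.delta 0 (W1.delta 0 a)"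
  have h: "?h a \<in> K" if a: "a \<in> carrier A" for a
  proof -
    obtain i where i: "a = f i"
      using a f by blast
    define m where "m = 2 * i + 1"
    define \<psi>' where "\<psi>' n = \<psi> (int m + n)" for n
    have \<psi>': "range \<psi>' \<subseteq> carrier W1.W"
      using \<psi> by (auto simp: \<psi>'_def)
    define c where "c = inv\<^bsub>W2.W\<^esub> W2.top (int m) \<otimes>\<^bsub>W2.W\<^esub> b \<otimes>\<^bsub>W2.W\<^esub> W2.top (int m)"
    have c: "c = W2.base \<psi>'"
      unfolding c_def b_def \<psi>'_def using W2.base_conj_top[OF _ \<psi>] by simp
    have cK: "c \<in> K"
      unfolding c_def by (intro subgroup.m_closed[OF K] subgroup.m_inv_closed[OF K] top btK)
    have "inv\<^bsub>W1.W\<^esub> \<psi> n \<otimes>\<^bsub>W1.W\<^esub> \<psi>' n \<otimes>\<^bsub>W1.W\<^esub> \<psi> n \<otimes>\<^bsub>W1.W\<^esub> inv\<^bsub>W1.W\<^esub> \<psi>' n =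
        (if n = 0 then W1.delta 0 a else \<one>\<^bsub>W1.W\<^esub>)" for n
    proof (cases "n = 0")
      case True
      \<comment> \<open>The shift by \<open>m\<close> brings the ray of \<open>f i\<close> to
        position 0, where it meets the translation \<open>\<psi> 0\<close>.\<close>
      have "\<psi>' 0 = W1.ray 1 0 a"
        by (simp add: \<psi>'_def \<psi>_def m_def i nat_add_distrib nat_mult_distrib)
      then show ?thesis
        using True W1.commutator_ray[of 1 0 a] a unit by (simp add: \<psi>_def del: funpow.simps)
    next
      case False
      \<comment> \<open>If \<open>n\<close> is positive and odd, then \<open>int m + n\<close> is
        positive and even, where \<open>\<psi>\<close> is trivial.\<close>
      have "\<psi> n = \<one>\<^bsub>W1.W\<^esub> \<or> \<psi>' n = \<one>\<^bsub>W1.W\<^esub>"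
        using False by (auto simp: \<psi>_def \<psi>'_def m_def)
      moreover have "\<psi> n \<in> carrier W1.W" "\<psi>' n \<in> carrier W1.W"
        using \<psi> \<psi>' by auto
      ultimately show ?thesis
        using False by (elim disjE) simp_all
    qed
    \<comment> \<open>Both \<open>b\<close> and \<open>c\<close> lie in the base group, where
      commutators are computed pointwise.\<close>
    then have "inv\<^bsub>W2.W\<^esub> b \<otimes>\<^bsub>W2.W\<^esub> c \<otimes>\<^bsub>W2.W\<^esub> b \<otimes>\<^bsub>W2.W\<^esub> inv\<^bsub>W2.W\<^esub> c = ?h a"
      unfolding c b_def W2.base_inv[OF \<psi>] W2.base_inv[OF \<psi>'] W2.base_mult W2.delta_def by presburger
    then show ?thesis
      using subgroup.m_closed[OF K] subgroup.m_inv_closed[OF K] btK cK by metis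
  qed
  have hom: "group_hom A W2.W ?h"
    using group_hom.homh[OF W1.group_hom_delta[of 0]] group_hom.homh[OF W2.group_hom_delta[of 0]]
      Group.hom_compose by unfold_locales (fastforce simp: comp_def)
  have "group_hom A ?G ?h"
    using group_hom.homh[OF hom] h by unfold_locales (auto simp: hom_def)
  moreover have "inj_on ?h (carrier A)"
    using inj_compose[OF W2.inj_delta W1.inj_delta] by (auto simp: comp_def intro: inj_on_subset)
  moreover have "subnormal (?h ` carrier A) ?G"
  proof (rule W2.W.subnormal_Int[OF _ K])
    show "subnormal (?h ` carrier A) W2.W"
      using group_hom.subnormal_image[OF W2.group_hom_delta W1.subnormal_delta W2.subnormal_delta]
      by (simp add: image_image)
  qed (use h in blast)
  moreover have "K \<lesssim> (UNIV :: nat set)"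
    unfolding K_def by (rule W2.W.generate_lepoll[OF _ bt]) (auto intro: finite_lepoll_infinite)
  then have "countable (carrier ?G)"
    using countable_lepoll[OF countableI_type] by simp
  moreover have "two_generated ?G"
  proof -
    have "generate ?G {b, t} = K"
      using W2.W.generate_consistent[OF _ K, of "{b, t}"] btK K_def by simp
    then show ?thesis
      unfolding two_generated_def using btK by (intro bexI[of _ b] bexI[of _ t]) simp_all
  qed
  moreover have "solvable integer_group"
    by (intro solvable_comm_group group.group_comm_groupI) auto
  then have "solvable A \<longrightarrow> solvable ?G"
    using W2.W.solvable_subgroup_group[OF _ K] W2.solvable_W W1.solvable_W by blast
  ultimately show ?thesis
    by blast
qed

section \<open>The embedding theorem\<close>

lemma two_generated_image:
  assumes "group_hom G H h" "h ` carrier G = carrier H" "two_generated G"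
  shows "two_generated H"
proof -
  interpret group_hom G H h by fact
  obtain a b where ab: "a \<in> carrier G" "b \<in> carrier G" "generate G {a, b} = carrier G"
    using assms(3) unfolding two_generated_def by blast
  then have "generate H {h a, h b} = carrier H"
    using generate_img[of "{a, b}"] assms(2) by simp
  then show ?thesis
    unfolding two_generated_def using ab(1,2) by (intro bexI[of _ "h a"] bexI[of _ "h b"]) simp_all
qed

lemma subnormal_verbal_embedding_lepoll:
  assumes "group G" "subnormal_verbal_embedding V H G"
  shows "carrier H \<lesssim> carrier G"
proof -
  interpret group G by fact
  obtain S where S: "subnormal S G" "(G\<lparr>carrier := S\<rparr>) \<cong> H"
    using assms(2) unfolding subnormal_verbal_embedding_def by blast
  then obtain g where "bij_betw g S (carrier H)"
    by (auto simp: is_iso_def iso_def)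
  then have "carrier H \<approx> S"
    using eqpoll_def eqpoll_sym by blast
  also have "S \<lesssim> carrier G"
    using subnormal_subgroup[OF S(1)] by (intro subset_imp_lepoll subgroup.subset)
  finally show ?thesis .
qed

text \<open>The embedded copy of \<open>H\<close> gives the converse comparison, so the
  cardinalities agree and \<open>G\<close> can be carried over to the elements of
  \<open>H\<close>.\<close>

lemma transport_embedding:
  fixes H :: "('a, 'b) monoid_scheme" and G :: "('c, 'd) monoid_scheme"
  assumes G: "group G" "carrier G \<lesssim> carrier H" "subnormal_verbal_embedding V H G"
    and V: "V \<subseteq> carrier F\<^sub>\<infinity>"
  shows "\<exists>G' :: 'a monoid. group G' \<and> carrier G' \<approx> carrier H \<and> subnormal_verbal_embedding V H G' \<and>
    (two_generated G \<longrightarrow> two_generated G') \<and> (solvable G \<longrightarrow> solvable G')"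
proof -
  interpret G: group G by (rule G(1))
  have "carrier G \<approx> carrier H"
    using G subnormal_verbal_embedding_lepoll lepoll_antisym by blast
  then obtain g where g: "bij_betw g (carrier G) (carrier H)"
    unfolding eqpoll_def by blast
  define G' where "G' = image_group g G"
  have inj: "inj_on g (carrier G)"
    using g bij_betw_imp_inj_on by blast
  have iso: "g \<in> iso G G'"
    unfolding G'_def by (rule inj_imp_image_group_iso[OF inj])
  have "group G'"
    unfolding G'_def by (rule G.inj_imp_image_group_is_group[OF inj])
  then interpret g: group_hom G G' g
    using iso G.group_axioms by (simp add: group_hom_def group_hom_axioms_def iso_def)
  have surj: "g ` carrier G = carrier G'"
    using iso by (simp add: iso_def bij_betw_def)
  have "carrier G' \<approx> carrier H"
    using g surj by (simp add: bij_betw_def)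
  moreover have "subnormal_verbal_embedding V H G'"
    using subnormal_verbal_embedding_trans[OF G(3) g.group_hom_axioms inj _ V]
      g.H.subnormal_carrier surj by simp
  ultimately show ?thesis
    using g.H.group_axioms g.surj_hom_imp_solvable[OF surj]
      two_generated_image[OF g.group_hom_axioms surj] by blast
qed

theorem theorem1:
  fixes H :: "('a, 'b) monoid_scheme" and V :: "letter list set"
  assumes "group H" and "infinite (carrier H)"
    and "V \<subseteq> carrier F\<^sub>\<infinity>" and "\<exists>w\<in>V. w \<noteq> \<one>\<^bsub>F\<^sub>\<infinity>\<^esub>"
  shows "(\<exists>G :: 'a monoid. group G \<and> carrier G \<approx> carrier H \<and> subnormal_verbal_embedding V H G)
    \<and> (countable (carrier H) \<longrightarrow>
        (\<exists>G :: 'a monoid. group G \<and> carrier G \<approx> carrier H \<and> subnormal_verbal_embedding V H G \<and>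
           two_generated G))
    \<and> (solvable H \<longrightarrow>
        (\<exists>G :: 'a monoid. group G \<and> carrier G \<approx> carrier H \<and> subnormal_verbal_embedding V H G \<and>
           solvable G)
        \<and> (countable (carrier H) \<longrightarrow>
            (\<exists>G :: 'a monoid. group G \<and> carrier G \<approx> carrier H \<and> subnormal_verbal_embedding V H G \<and>
               two_generated G \<and> solvable G)))"
proof -
  obtain w where "w \<in> V" "w \<in> carrier F\<^sub>\<infinity>" "w \<noteq> \<one>\<^bsub>F\<^sub>\<infinity>\<^esub>"
    using assms(3,4) by blast
  from verbal_embedding[OF assms(1,2) this]
  obtain G :: "(((nat \<Rightarrow> int) \<Rightarrow> 'a) \<times> ((nat \<Rightarrow> int) \<Rightarrow> nat \<Rightarrow> int)) monoid"
    where "group G" "carrier G \<lesssim> carrier H" "subnormal_verbal_embedding V H G"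
      "solvable H \<longrightarrow> solvable G"
    by blast
  from transport_embedding[OF this(1-3) assms(3)] this(4)
  obtain G :: "'a monoid" where G: "group G" "carrier G \<approx> carrier H"
      "subnormal_verbal_embedding V H G" "solvable H \<longrightarrow> solvable G"
    by blast
  \<comment> \<open>In the countable case \<open>G\<close> itself is embedded subnormally in a
    two-generated group, and the copy of \<open>H\<close> stays verbal and subnormal there.\<close>
  have "\<exists>G' :: 'a monoid. group G' \<and> carrier G' \<approx> carrier H \<and> subnormal_verbal_embedding V H G' \<and>
      two_generated G' \<and> (solvable G \<longrightarrow> solvable G')" if "countable (carrier H)"
  proof -
    have "countable (carrier G)"
      using countable_eqpoll[OF that G(2)] .
    then obtain E :: "((int \<Rightarrow> (int \<Rightarrow> 'a) \<times> int) \<times> int) monoid" and h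
      where h: "group_hom G E h" "inj_on h (carrier G)" "subnormal (h ` carrier G) E"
      and E: "countable (carrier E)" "two_generated E" "solvable G \<longrightarrow> solvable E"
      using countable_embedding[OF G(1)] by blast
    have "carrier E \<lesssim> (UNIV :: nat set)"
      using E(1) by (simp add: countable_def lepoll_def)
    then have "carrier E \<lesssim> carrier H"
      using assms(2) infinite_le_lepoll lepoll_trans by blast
    then show ?thesis
      using transport_embedding[OF _ _ subnormal_verbal_embedding_trans[OF G(3) h assms(3)] assms(3)]
        group_hom.axioms(2)[OF h(1)] E by blast
  qed
  then show ?thesis
    using G by meson
qed

end
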